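(* Let $a,b,c\in\mathbb{N}$ with $a\le b\le c$, $3a<b+c$ and $2b>c$. Then $f(a,b,c)=\left\lfloor \frac{2}{3}(b+c-1)\right\rfloor$.
   Context: $\mathbb{N}$ denotes the positive integers and $[n]=\{1,\dots,n\}$. For $a,b,c\in\mathbb{N}$, $f(a,b,c)$ denotes the metric dimension of the Cartesian product $K_a\times K_b\times K_c$ of complete graphs (vertex set $[a]\times[b]\times[c]$, two triples adjacent iff they differ in exactly one coordinate); the metric dimension of a graph is the minimum size of a vertex set $U$ such that every vertex is uniquely determined by its vector of distances to the vertices of $U$. Equivalently, $f(a,b,c)$ is the minimum cardinality of a set $Q\subseteq[a]\times[b]\times[c]$ such that for all distinct $s,s'$ there is $q\in Q$ with $g(s,q)\neq g(s',q)$, where $g(s,q)$ is the number of indices $i\in[3]$ with $s_i=q_i$. *)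

theory Defs
  imports Complex_Main "HOL-Library.Extended_Nat"
begin

text \<open>
  A graph is given by its vertex set and its adjacency relation; for an undirected simple graph
  the latter is a symmetric and irreflexive relation on the vertex set.
\<close>

record 'a graph =
  verts :: "'a set"
  adj :: "'a rel"

definition complete_graph :: "nat \<Rightarrow> nat graph" where
  "complete_graph n =
     \<lparr>verts = {1..n}, adj = {(i, j). i \<in> {1..n} \<and> j \<in> {1..n} \<and> i \<noteq> j}\<rparr>"

definition cartesian_product :: "'a graph \<Rightarrow> 'b graph \<Rightarrow> ('a \<times> 'b) graph"  (infixr "\<box>" 70) where
  "G \<box> H =
     \<lparr>verts = verts G \<times> verts H,
      adj = {((x, y), (x', y')).
        x = x' \<and> x \<in> verts G \<and> (y, y') \<in> adj H \<or>
        (x, x') \<in> adj G \<and> y = y' \<and> y \<in> verts H}\<rparr>"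

text \<open>
  The pairs in \<open>adj G ^^ n\<close> are those joined by a walk of length \<open>n\<close>. The infimum over the empty
  set in \<^typ>\<open>enat\<close> is \<open>\<infinity>\<close>, so this is the distance between vertices in distinct components.
\<close>

definition graph_dist :: "'a graph \<Rightarrow> 'a \<Rightarrow> 'a \<Rightarrow> enat" where
  "graph_dist G x y = (INF n\<in>{n. (x, y) \<in> adj G ^^ n}. enat n)"

definition resolving_set :: "'a graph \<Rightarrow> 'a set \<Rightarrow> bool" where
  "resolving_set G U \<longleftrightarrow> U \<subseteq> verts G \<and>
     (\<forall>x\<in>verts G. \<forall>y\<in>verts G. (\<forall>u\<in>U. graph_dist G x u = graph_dist G y u) \<longrightarrow> x = y)"

text \<open>For finite \<open>G\<close> the set \<^term>\<open>verts G\<close> is itself resolving, so the minimum exists.\<close>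

definition metric_dimension :: "'a graph \<Rightarrow> nat" where
  "metric_dimension G = (LEAST n. \<exists>U. finite U \<and> resolving_set G U \<and> card U = n)"

lemma verts_product_complete:
  "verts (complete_graph a \<box> complete_graph b \<box> complete_graph c) = {1..a} \<times> {1..b} \<times> {1..c}"
  by (simp add: complete_graph_def cartesian_product_def)

text \<open>Two triples are adjacent iff they differ in exactly one coordinate.\<close>

lemma adj_product_complete:
  assumes "(x, y, z) \<in> {1..a} \<times> {1..b} \<times> {1..c}" "(x', y', z') \<in> {1..a} \<times> {1..b} \<times> {1..c}"
  shows "((x, y, z), (x', y', z')) \<in> adj (complete_graph a \<box> complete_graph b \<box> complete_graph c)
    \<longleftrightarrow> of_bool (x \<noteq> x') + of_bool (y \<noteq> y') + of_bool (z \<noteq> z') = (1 :: nat)"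
  using assms by (auto simp: complete_graph_def cartesian_product_def)

end

theory Submission imports Defs begin

text \<open>
  Two triples at distance \<open>d\<close> agree in \<open>3 - d\<close> coordinates. Comparing only triples with equal first
  coordinate, the projection of a resolving set to the last two coordinates is a bipartite graph on
  \<open>b + c\<close> vertices with at most one isolated vertex on each side, at most one single-edge component,
  and not all three of these; every other component has at least \<open>2/3\<close> as many edges as vertices.
  Conversely, disjoint paths with two edges attain the bound. The first coordinates are chosen so that
  (almost) every colour occurs on two such paths of the same kind; then, for triples with distinct
  first coordinates, all edges in the colour of one triple would share a vertex, a contradiction.
\<close>

section \<open>Distances in the product\<close>

definition agree :: "'a \<times> 'b \<times> 'c \<Rightarrow> 'a \<times> 'b \<times> 'c \<Rightarrow> nat" where
  "agree s q = of_bool (fst s = fst q) + of_bool (fst (snd s) = fst (snd q))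
     + of_bool (snd (snd s) = snd (snd q))"

lemma agree_simp [simp]:
  "agree (x, y, z) (u, v, w) = of_bool (x = u) + of_bool (y = v) + of_bool (z = w)"
  by (simp add: agree_def)

text \<open>The coordinate sets have arbitrary types so that the upper bound can be built over named
  vertices.\<close>

definition resolves :: "'a set \<Rightarrow> 'b set \<Rightarrow> 'c set \<Rightarrow> ('a \<times> 'b \<times> 'c) set \<Rightarrow> bool" where
  "resolves A B C Q \<longleftrightarrow> Q \<subseteq> A \<times> B \<times> C \<and>
     (\<forall>s\<in>A \<times> B \<times> C. \<forall>s'\<in>A \<times> B \<times> C. (\<forall>q\<in>Q. agree s q = agree s' q) \<longrightarrow> s = s')"

abbreviation K3 :: "nat \<Rightarrow> nat \<Rightarrow> nat \<Rightarrow> (nat \<times> nat \<times> nat) graph" where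
  "K3 a b c \<equiv> complete_graph a \<box> complete_graph b \<box> complete_graph c"

text \<open>A step alters one coordinate and so loses at most one agreement with \<open>s\<close>;
  at the start all three are present.\<close>

lemma agree_walk:
  assumes "(s, q) \<in> adj (K3 a b c) ^^ n" "s \<in> verts (K3 a b c)"
  shows "q \<in> verts (K3 a b c) \<and> 3 \<le> agree s q + n"
  using assms
proof (induction n arbitrary: q)
  case 0
  then show ?case by (simp add: agree_def)
next
  case (Suc n)
  then obtain m where m: "(s, m) \<in> adj (K3 a b c) ^^ n" "(m, q) \<in> adj (K3 a b c)"
    by auto
  obtain x y z u v w x' y' z' where e: "s = (x, y, z)" "q = (u, v, w)" "m = (x', y', z')"
    by (metis prod_cases3)
  have "3 \<le> agree s m + n" "m \<in> verts (K3 a b c)" using Suc.IH[OF m(1) Suc.prems(2)] by auto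
  moreover have "q \<in> verts (K3 a b c)"
    using m(2) by (auto simp: complete_graph_def cartesian_product_def)
  moreover have "agree s m \<le> agree s q + 1"
    using m(2) unfolding e by (auto simp: complete_graph_def cartesian_product_def)
  ultimately show ?case by simp
qed

lemma walk_agree:
  assumes "(x, y, z) \<in> {1..a} \<times> {1..b} \<times> {1..c}" "(u, v, w) \<in> {1..a} \<times> {1..b} \<times> {1..c}"
  shows "((x, y, z), (u, v, w)) \<in> adj (K3 a b c) ^^ (3 - agree (x, y, z) (u, v, w))"
proof -
  let ?R = "adj (K3 a b c)"
  have 1: "((x, y, z), (u, y, z)) \<in> ?R ^^ of_bool (x \<noteq> u)"
    using assms by (auto simp: complete_graph_def cartesian_product_def)
  have 2: "((u, y, z), (u, v, z)) \<in> ?R ^^ of_bool (y \<noteq> v)"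
    using assms by (auto simp: complete_graph_def cartesian_product_def)
  have 3: "((u, v, z), (u, v, w)) \<in> ?R ^^ of_bool (z \<noteq> w)"
    using assms by (auto simp: complete_graph_def cartesian_product_def)
  have "((x, y, z), (u, v, w)) \<in> ?R ^^ (of_bool (x \<noteq> u) + of_bool (y \<noteq> v) + of_bool (z \<noteq> w))"
    unfolding relpow_add using 1 2 3 by blast
  moreover have "of_bool (x \<noteq> u) + of_bool (y \<noteq> v) + of_bool (z \<noteq> w)
      = 3 - agree (x, y, z) (u, v, w)" by simp
  ultimately show ?thesis by metis
qed

lemma graph_dist_K3:
  assumes "s \<in> {1..a} \<times> {1..b} \<times> {1..c}" "q \<in> {1..a} \<times> {1..b} \<times> {1..c}"
  shows "graph_dist (K3 a b c) s q = enat (3 - agree s q)"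
  unfolding graph_dist_def
proof (rule antisym)
  have "(s, q) \<in> adj (K3 a b c) ^^ (3 - agree s q)"
    using assms walk_agree by (metis prod_cases3)
  then show "(INF n\<in>{n. (s, q) \<in> adj (K3 a b c) ^^ n}. enat n) \<le> enat (3 - agree s q)"
    by (intro INF_lower) simp
  show "enat (3 - agree s q) \<le> (INF n\<in>{n. (s, q) \<in> adj (K3 a b c) ^^ n}. enat n)"
  proof (rule INF_greatest)
    fix n assume "n \<in> {n. (s, q) \<in> adj (K3 a b c) ^^ n}"
    then have "3 \<le> agree s q + n"
      using agree_walk assms(1) unfolding verts_product_complete by blast
    then show "enat (3 - agree s q) \<le> enat n" by simp
  qed
qed

lemma agree_le: "agree s q \<le> 3"
  by (simp add: agree_def)

lemma resolving_set_K3: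
  "resolving_set (K3 a b c) Q \<longleftrightarrow> resolves {1..a} {1..b} {1..c} Q"
proof -
  have "(graph_dist (K3 a b c) s q = graph_dist (K3 a b c) s' q) = (agree s q = agree s' q)"
    if "s \<in> {1..a} \<times> {1..b} \<times> {1..c}" "s' \<in> {1..a} \<times> {1..b} \<times> {1..c}"
      "q \<in> {1..a} \<times> {1..b} \<times> {1..c}" for s s' q
    \<comment> \<open>Truncated subtraction from 3 is injective only on values up to 3.\<close>
    using that agree_le[of s q] agree_le[of s' q] by (simp add: graph_dist_K3, linarith)
  then show ?thesis
    unfolding resolving_set_def resolves_def verts_product_complete
    by (smt (verit) subsetD)
qed

section \<open>Lower bound\<close>

lemma two_le_card: "2 \<le> card S" if "finite S" "card S \<noteq> 1" "S \<noteq> {}"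
proof -
  have "card S \<noteq> 0" using that by simp
  with that(2) show ?thesis by simp
qed

text \<open>
  Discharging on the bipartite graph \<open>P\<close>: every edge holds charge 3 and every vertex asks for 2.
  Only isolated vertices and single-edge components are left short, by 2 and by 1.
\<close>

lemma resolves_card_lower:
  fixes A :: "'a set" and B :: "'b set" and C :: "'c set"
  assumes res: "resolves A B C Q" and fin: "finite Q" "finite B" "finite C"
    and ne: "A \<noteq> {}" "B \<noteq> {}" "C \<noteq> {}"
  shows "2 * (card B + card C) \<le> 3 * card Q + 4"
proof -
  define P where "P = snd ` Q"
  have P: "P \<subseteq> B \<times> C" "finite P" "card P \<le> card Q"
    using res fin by (auto simp: P_def resolves_def card_image_le)
  obtain x where x: "x \<in> A" using ne by auto
  \<comment> \<open>Both pairs are completed by the same \<open>x\<close>, whose contribution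
    cancels, so \<open>P\<close> alone has to tell them apart.\<close>
  have sep: "y = y' \<and> z = z'"
    if "y \<in> B" "y' \<in> B" "z \<in> C" "z' \<in> C"
      "\<And>v w. (v, w) \<in> P \<Longrightarrow>
        (of_bool (y = v) + of_bool (z = w) :: nat) = of_bool (y' = v) + of_bool (z' = w)"
    for y y' z z'
  proof -
    have "\<forall>q\<in>Q. agree (x, y, z) q = agree (x, y', z') q"
    proof
      fix q assume q: "q \<in> Q"
      obtain u v w where e: "q = (u, v, w)" by (metis prod_cases3)
      with q have "(v, w) \<in> P" by (force simp: P_def)
      from that(5)[OF this] show "agree (x, y, z) q = agree (x, y', z') q" by (simp add: e)
    qed
    then show ?thesis using res x that(1-4) unfolding resolves_def by blast
  qed
  define NB where "NB y = {z \<in> C. (y, z) \<in> P}" for y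
  define NC where "NC z = {y \<in> B. (y, z) \<in> P}" for z
  have finN: "finite (NB y)" "finite (NC z)" for y z
    using fin by (auto simp: NB_def NC_def)
  \<comment> \<open>A vertex of degree 1 gets 2 from its only edge, any other endpoint gets 1. If
    both ends have degree 1, the end in \<open>B\<close> has precedence; hence no edge spends more
    than 3.\<close>
  define wB :: "'b \<Rightarrow> 'c \<Rightarrow> nat" where "wB y z = (if card (NB y) = 1 then 2 else 1)" for y z
  define wC :: "'b \<Rightarrow> 'c \<Rightarrow> nat" where
    "wC y z = (if card (NC z) = 1 \<and> card (NB y) \<noteq> 1 then 2 else 1)" for y z
  define IB where "IB = {y \<in> B. NB y = {}}"
  define IC where "IC = {z \<in> C. NC z = {}}"
  \<comment> \<open>The ends in \<open>C\<close> of single-edge components, which receive only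
    1.\<close>
  define K where "K = {z \<in> C. \<exists>y. NC z = {y} \<and> card (NB y) = 1}"
  have B: "2 \<le> (\<Sum>z\<in>NB y. wB y z) + 2 * of_bool (NB y = {})" for y
    using two_le_card[OF finN(1)[of y]] by (cases "NB y = {}") (auto simp: wB_def)
  have C: "2 \<le> (\<Sum>y\<in>NC z. wC y z) + 2 * of_bool (NC z = {})
      + of_bool (\<exists>y. NC z = {y} \<and> card (NB y) = 1)" for z
  proof (cases "card (NC z) = 1")
    case True
    then obtain y where "NC z = {y}" by (auto simp: card_1_singleton_iff)
    then show ?thesis by (auto simp: wC_def)
  next
    case False
    then have "(\<Sum>y\<in>NC z. wC y z) = card (NC z)" by (simp add: wC_def)
    with False two_le_card[OF finN(2)[of z]] show ?thesis by (cases "NC z = {}") auto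
  qed
  have PB: "P = Sigma B NB" and PC: "P = (\<lambda>(z, y). (y, z)) ` Sigma C NC"
    using P(1) by (force simp: NB_def NC_def)+
  have sumB: "(\<Sum>y\<in>B. \<Sum>z\<in>NB y. wB y z) = (\<Sum>(y, z)\<in>P. wB y z)"
    unfolding PB using fin finN by (intro sum.Sigma) auto
  have "(\<Sum>z\<in>C. \<Sum>y\<in>NC z. wC y z) = (\<Sum>(z, y)\<in>Sigma C NC. wC y z)"
    using fin finN by (intro sum.Sigma) auto
  also have "\<dots> = (\<Sum>(y, z)\<in>P. wC y z)"
    unfolding PC by (subst sum.reindex) (auto simp: inj_on_def intro!: sum.cong)
  finally have sumC: "(\<Sum>z\<in>C. \<Sum>y\<in>NC z. wC y z) = (\<Sum>(y, z)\<in>P. wC y z)" .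
  have cB: "(\<Sum>y\<in>B. of_bool (NB y = {})) = card IB"
    using fin by (simp add: IB_def of_bool_def sum.If_cases Int_def)
  have cC: "(\<Sum>z\<in>C. of_bool (NC z = {})) = card IC"
    using fin by (simp add: IC_def of_bool_def sum.If_cases Int_def)
  have cK: "(\<Sum>z\<in>C. of_bool (\<exists>y. NC z = {y} \<and> card (NB y) = 1)) = card K"
    using fin by (simp add: K_def of_bool_def sum.If_cases Int_def)
  have "2 * card B \<le> (\<Sum>y\<in>B. (\<Sum>z\<in>NB y. wB y z) + 2 * of_bool (NB y = {}))"
    using sum_mono[of B "\<lambda>_. 2", OF B] by (simp add: mult.commute)
  then have 1: "2 * card B \<le> (\<Sum>(y, z)\<in>P. wB y z) + 2 * card IB"
    by (simp only: sum.distrib sumB cB flip: sum_distrib_left)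
  have "2 * card C \<le> (\<Sum>z\<in>C. (\<Sum>y\<in>NC z. wC y z) + 2 * of_bool (NC z = {})
      + of_bool (\<exists>y. NC z = {y} \<and> card (NB y) = 1))"
    using sum_mono[of C "\<lambda>_. 2", OF C] by (simp add: mult.commute)
  then have 2: "2 * card C \<le> (\<Sum>(y, z)\<in>P. wC y z) + 2 * card IC + card K"
    by (simp only: sum.distrib sumC cC cK flip: sum_distrib_left)
  have "(\<Sum>(y, z)\<in>P. wB y z) + (\<Sum>(y, z)\<in>P. wC y z) = (\<Sum>(y, z)\<in>P. wB y z + wC y z)"
    by (simp add: sum.distrib case_prod_unfold)
  also have "\<dots> \<le> (\<Sum>_\<in>P. 3)"
    by (intro sum_mono) (auto simp: wB_def wC_def)
  finally have 3: "(\<Sum>(y, z)\<in>P. wB y z) + (\<Sum>(y, z)\<in>P. wC y z) \<le> 3 * card P" by simp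
  \<comment> \<open>Two isolated vertices of \<open>B\<close>, paired with the same
    \<open>z\<close>, agree equally with every edge.\<close>
  have IB1: "card IB \<le> 1"
  proof -
    have "y = y'" if "y \<in> IB" "y' \<in> IB" for y y'
    proof -
      obtain z where "z \<in> C" using ne by auto
      with that P(1) show ?thesis
        by (intro sep[of y y' z z, THEN conjunct1]) (auto simp: IB_def NB_def)
    qed
    then show ?thesis using fin by (simp add: card_le_Suc0_iff_eq IB_def)
  qed
  have IC1: "card IC \<le> 1"
  proof -
    have "z = z'" if "z \<in> IC" "z' \<in> IC" for z z'
    proof -
      obtain y where "y \<in> B" using ne by auto
      with that P(1) show ?thesis
        by (intro sep[of y y z z', THEN conjunct2]) (auto simp: IC_def NC_def)
    qed
    then show ?thesis using fin by (simp add: card_le_Suc0_iff_eq IC_def)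
  qed
  have edge: "\<exists>y\<in>B. \<forall>v w. (v, w) \<in> P \<longrightarrow> (y = v \<longleftrightarrow> z = w)" if K: "z \<in> K" for z
  proof -
    obtain y z' where *: "NC z = {y}" "NB y = {z'}"
      using K by (auto simp: K_def card_1_singleton_iff)
    then have "z' = z" using that by (auto simp: NB_def NC_def K_def)
    have "\<forall>v w. (v, w) \<in> P \<longrightarrow> (y = v \<longleftrightarrow> z = w)"
    proof (intro allI impI)
      fix v w assume "(v, w) \<in> P"
      then have "w \<in> NB v" "v \<in> NC w" using P(1) by (auto simp: NB_def NC_def)
      with * \<open>z' = z\<close> show "y = v \<longleftrightarrow> z = w" by auto
    qed
    then show ?thesis using * by (auto simp: NC_def)
  qed
  have K1: "card K \<le> 1"
  proof -
    have "z = z'" if zz: "z \<in> K" "z' \<in> K" for z z'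
    proof -
      obtain y where y: "y \<in> B" "\<forall>v w. (v, w) \<in> P \<longrightarrow> (y = v \<longleftrightarrow> z = w)"
        using edge[OF zz(1)] by blast
      obtain y' where y': "y' \<in> B" "\<forall>v w. (v, w) \<in> P \<longrightarrow> (y' = v \<longleftrightarrow> z' = w)"
        using edge[OF zz(2)] by blast
      have "z \<in> C" "z' \<in> C" using zz by (simp_all add: K_def)
      \<comment> \<open>Ends are crossed: for two different such edges, \<open>(y', z)\<close> and
        \<open>(y, z')\<close> meet each of the two once and no other edge.\<close>
      with y y' show ?thesis by (intro sep[of y' y z z', THEN conjunct2]) simp_all
    qed
    then show ?thesis using fin by (simp add: card_le_Suc0_iff_eq K_def)
  qed
  have "card IB + card IC + card K \<le> 2"
  proof (rule ccontr)
    assume "\<not> ?thesis"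
    then have "card IB \<noteq> 0" "card IC \<noteq> 0" "card K \<noteq> 0" using IB1 IC1 K1 by auto
    then obtain y z k where k: "y \<in> IB" "z \<in> IC" "k \<in> K" by (metis card.empty ex_in_conv)
    then obtain l where l: "l \<in> B" "\<forall>v w. (v, w) \<in> P \<longrightarrow> (l = v \<longleftrightarrow> k = w)"
      using edge by blast
    \<comment> \<open>With \<open>y\<close> and \<open>z\<close> isolated, \<open>(l, z)\<close> and
      \<open>(y, k)\<close> both meet just the edge from \<open>l\<close> to \<open>k\<close>,
      once.\<close>
    have "z = k"
      using k l P(1)
      by (intro sep[of l y z k, THEN conjunct2]) (auto simp: IB_def IC_def NB_def NC_def K_def)
    moreover have "NC z = {}" "NC k \<noteq> {}" using k by (auto simp: IC_def K_def)
    ultimately show False by simp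
  qed
  \<comment> \<open>Each isolated vertex is short by 2 and a single-edge component by 1, so
    \<open>i + j + k \<le> 2\<close> caps the deficit at 4.\<close>
  moreover have "2 * n \<le> 3 * q' + 4"
    if "2 * m \<le> s + 2 * i" "2 * l \<le> t + 2 * j + k" "s + t \<le> 3 * q" "q \<le> q'" "i + j + k \<le> 2"
      "n = m + l" for m l n s t i j k q q' :: nat
    using that by linarith
  ultimately show ?thesis using 1 2 3 P(3) by blast
qed

section \<open>Upper bound\<close>

text \<open>
  The second and third coordinates of the resolving set form a bipartite graph: \<open>p\<close> paths with
  centre \<open>YC i\<close> and leaves \<open>ZL i t\<close>, \<open>r\<close> paths with centre \<open>ZC j\<close> and leaves \<open>YL j t\<close>, possibly
  the edge joining \<open>YK\<close> and \<open>ZI\<close>, and isolated vertices. The first coordinate of a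
  triple is regarded as a colour of the edge, given by \<open>\<kappa>\<close> and \<open>\<mu>\<close> on the paths.
\<close>

datatype second = YC nat | YL nat bool | YI | YK
datatype third = ZC nat | ZL nat bool | ZI

text \<open>\<open>d\<close> stands for the edge from \<open>YK\<close> to \<open>ZI\<close>,
  \<open>e\<close> for the vertex \<open>ZI\<close>, isolated if \<open>d\<close> fails. As
  \<open>YI\<close> is always isolated, two of the three exceptions allowed by the lower bound can
  be present, never all three.\<close>

definition seconds :: "nat \<Rightarrow> nat \<Rightarrow> bool \<Rightarrow> second set" where
  "seconds p r d = YC ` {..<p} \<union> (\<lambda>(j, t). YL j t) ` ({..<r} \<times> UNIV) \<union> {YI} \<union> {y. d \<and> y = YK}"

definition thirds :: "nat \<Rightarrow> nat \<Rightarrow> bool \<Rightarrow> third set" where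
  "thirds p r e = ZC ` {..<r} \<union> (\<lambda>(i, t). ZL i t) ` ({..<p} \<times> UNIV) \<union> {z. e \<and> z = ZI}"

definition path_set ::
    "nat \<Rightarrow> nat \<Rightarrow> bool \<Rightarrow> (nat \<Rightarrow> bool \<Rightarrow> nat) \<Rightarrow> (nat \<Rightarrow> bool \<Rightarrow> nat) \<Rightarrow> (nat \<times> second \<times> third) set"
  where "path_set p r d \<kappa> \<mu> =
    (\<lambda>(i, t). (\<kappa> i t, YC i, ZL i t)) ` ({..<p} \<times> UNIV) \<union>
    (\<lambda>(j, t). (\<mu> j t, YL j t, ZC j)) ` ({..<r} \<times> UNIV) \<union> {q. d \<and> q = (0, YK, ZI)}"

lemma mem_seconds:
  "YC i \<in> seconds p r d \<longleftrightarrow> i < p" "YL j t \<in> seconds p r d \<longleftrightarrow> j < r"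
  "YI \<in> seconds p r d" "YK \<in> seconds p r d \<longleftrightarrow> d"
  by (auto simp: seconds_def image_iff)

lemma mem_thirds:
  "ZC j \<in> thirds p r e \<longleftrightarrow> j < r" "ZL i t \<in> thirds p r e \<longleftrightarrow> i < p" "ZI \<in> thirds p r e \<longleftrightarrow> e"
  by (auto simp: thirds_def image_iff)

lemma card_seconds: "card (seconds p r d) = p + 2 * r + 1 + of_bool d"
proof -
  have "card (YC ` {..<p} \<union> (\<lambda>(j, t). YL j t) ` ({..<r} \<times> UNIV)) = p + 2 * r"
    by (subst card_Un_disjoint) (auto simp: card_image inj_on_def card_cartesian_product)
  then show ?thesis unfolding seconds_def
    by (cases d) (auto simp: card_insert_if)
qed

lemma card_thirds: "card (thirds p r e) = 2 * p + r + of_bool e"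
proof -
  have "card (ZC ` {..<r} \<union> (\<lambda>(i, t). ZL i t) ` ({..<p} \<times> UNIV)) = 2 * p + r"
    by (subst card_Un_disjoint) (auto simp: card_image inj_on_def card_cartesian_product)
  then show ?thesis unfolding thirds_def
    by (cases e) (auto simp: card_insert_if)
qed

lemma finite_path_set: "finite (path_set p r d \<kappa> \<mu>)"
  by (simp add: path_set_def)

lemma card_path_set: "card (path_set p r d \<kappa> \<mu>) \<le> 2 * p + 2 * r + of_bool d"
proof -
  let ?S = "(\<lambda>(i, t). (\<kappa> i t, YC i, ZL i t)) ` ({..<p} \<times> UNIV)"
  let ?T = "(\<lambda>(j, t). (\<mu> j t, YL j t, ZC j)) ` ({..<r} \<times> UNIV)"
  have "card ?S \<le> 2 * p"
    by (rule order_trans[OF card_image_le]) (auto simp: card_cartesian_product)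
  moreover have "card ?T \<le> 2 * r"
    by (rule order_trans[OF card_image_le]) (auto simp: card_cartesian_product)
  moreover have "card {q :: nat \<times> second \<times> third. d \<and> q = (0, YK, ZI)} = of_bool d"
    by (cases d) auto
  ultimately show ?thesis
    unfolding path_set_def
    using card_Un_le[of ?S ?T] card_Un_le[of "?S \<union> ?T" "{q. d \<and> q = (0, YK, ZI)}"] by linarith
qed

section \<open>Separating triples by coloured paths\<close>

definition twice :: "nat \<Rightarrow> (nat \<Rightarrow> bool \<Rightarrow> nat) \<Rightarrow> nat \<Rightarrow> bool" where
  "twice n \<kappa> x \<longleftrightarrow> (\<exists>i i' t t'. i < n \<and> i' < n \<and> i \<noteq> i' \<and>
     \<kappa> i t = x \<and> \<kappa> i' t' = x \<and> \<kappa> i (\<not> t) \<noteq> x \<and> \<kappa> i' (\<not> t') \<noteq> x)"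

lemma path_setI:
  "i < p \<Longrightarrow> (\<kappa> i t, YC i, ZL i t) \<in> path_set p r d \<kappa> \<mu>"
  "j < r \<Longrightarrow> (\<mu> j t, YL j t, ZC j) \<in> path_set p r d \<kappa> \<mu>"
  "d \<Longrightarrow> (0, YK, ZI) \<in> path_set p r d \<kappa> \<mu>"
  by (auto simp: path_set_def image_iff)

lemma agree_path_set:
  assumes "\<forall>q\<in>path_set p r d \<kappa> \<mu>. agree (x, y, z) q = agree (x', y', z') q"
  shows "i < p \<Longrightarrow> (of_bool (x = \<kappa> i t) + of_bool (y = YC i) + of_bool (z = ZL i t) :: nat)
      = of_bool (x' = \<kappa> i t) + of_bool (y' = YC i) + of_bool (z' = ZL i t)"
    and "j < r \<Longrightarrow> (of_bool (x = \<mu> j t) + of_bool (y = YL j t) + of_bool (z = ZC j) :: nat)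
      = of_bool (x' = \<mu> j t) + of_bool (y' = YL j t) + of_bool (z' = ZC j)"
    and "d \<Longrightarrow> (of_bool (x = 0) + of_bool (y = YK) + of_bool (z = ZI) :: nat)
      = of_bool (x' = 0) + of_bool (y' = YK) + of_bool (z' = ZI)"
proof -
  note * = assms[THEN bspec]
  show "i < p \<Longrightarrow> (of_bool (x = \<kappa> i t) + of_bool (y = YC i) + of_bool (z = ZL i t) :: nat)
      = of_bool (x' = \<kappa> i t) + of_bool (y' = YC i) + of_bool (z' = ZL i t)"
    using *[OF path_setI(1)] by (simp only: agree_simp)
  show "j < r \<Longrightarrow> (of_bool (x = \<mu> j t) + of_bool (y = YL j t) + of_bool (z = ZC j) :: nat)
      = of_bool (x' = \<mu> j t) + of_bool (y' = YL j t) + of_bool (z' = ZC j)"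
    using *[OF path_setI(2)] by (simp only: agree_simp)
  show "d \<Longrightarrow> (of_bool (x = 0) + of_bool (y = YK) + of_bool (z = ZI) :: nat)
      = of_bool (x' = 0) + of_bool (y' = YK) + of_bool (z' = ZI)"
    using *[OF path_setI(3)] by (simp only: agree_simp)
qed

lemma of_bool_sum_eq_iff:
  "(of_bool P + of_bool Q :: nat) = of_bool R + of_bool S
    \<longleftrightarrow> (P \<and> Q \<longleftrightarrow> R \<and> S) \<and> (P \<or> Q \<longleftrightarrow> R \<or> S)"
  by (cases P; cases Q; cases R; cases S; simp)

text \<open>No coordinate equals both leaves of a path, so the two edges of a path reveal its centre
  and leaves. What remains is \<open>ZI\<close> for the third coordinate, and \<open>YI\<close> or
  \<open>YK\<close> for the second, told apart by the edge at \<open>ZI\<close>.\<close>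

lemma path_set_same_colour:
  assumes eq: "\<forall>q\<in>path_set p r d \<kappa> \<mu>. agree (x, y, z) q = agree (x, y', z') q"
    and y: "y \<in> seconds p r d" "y' \<in> seconds p r d" and z: "z \<in> thirds p r e" "z' \<in> thirds p r e"
  shows "y = y' \<and> z = z'"
proof -
  note ag = agree_path_set[OF eq, unfolded add.assoc add_left_cancel of_bool_sum_eq_iff]
  have yc: "y = YC i \<longleftrightarrow> y' = YC i" if "i < p" for i
    using ag(1)[OF that, of True] ag(1)[OF that, of False] by auto
  have yl: "y = YL j t \<longleftrightarrow> y' = YL j t" if "j < r" for j t
    using ag(2)[OF that, of True] ag(2)[OF that, of False]
    by (cases t) auto
  have zl: "z = ZL i t \<longleftrightarrow> z' = ZL i t" if "i < p" for i t
    using ag(1)[OF that, of t] yc[OF that] by blast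
  have zc: "z = ZC j \<longleftrightarrow> z' = ZC j" if "j < r" for j
    using ag(2)[OF that, of True] yl[OF that, of True] by blast
  have zz: "z = z'" using z zl zc by (metis third.exhaust mem_thirds)
  have "d \<Longrightarrow> y = YK \<longleftrightarrow> y' = YK" using ag(3) zz by blast
  then have "y = y'" using y yl yc by (metis second.exhaust mem_seconds)
  with zz show ?thesis by simp
qed

text \<open>The first triple meets, by its colour, edges on two paths. The second has another
  colour, so it must hold the centre of one path and a leaf of the other. This pins \<open>z\<close>
  to a leaf whose only edge lacks the colour \<open>x'\<close>, so edges of colour \<open>x'\<close>
  can be met only in \<open>y\<close>.\<close>

lemma path_set_twice_second:
  assumes eq: "\<forall>q\<in>path_set p r d \<kappa> \<mu>. agree (x, y, z) q = agree (x', y', z') q"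
    and ne: "x \<noteq> x'" and tw: "twice p \<kappa> x"
    and v: "(x', v, w) \<in> path_set p r d \<kappa> \<mu>"
  shows "v = y"
proof -
  note ag = agree_path_set[OF eq]
  obtain i i' t t' where i: "i < p" "i' < p" "i \<noteq> i'" "\<kappa> i t = x" "\<kappa> i' t' = x"
    "\<kappa> i (\<not> t) \<noteq> x" and y': "y' = YC i"
  proof -
    obtain i i' t t' where i: "i < p" "i' < p" "i \<noteq> i'" "\<kappa> i t = x" "\<kappa> i' t' = x"
      "\<kappa> i (\<not> t) \<noteq> x" "\<kappa> i' (\<not> t') \<noteq> x" using tw unfolding twice_def by blast
    have "y' = YC i \<or> y' = YC i'"
      using ag(1)[OF i(1), of t] ag(1)[OF i(2), of t'] i ne
      by (auto simp: of_bool_def split: if_splits)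
    then show ?thesis using i that[of i i' t t'] that[of i' i t' t] by metis
  qed
  have z': "z' = ZL i' t'" using ag(1)[OF i(2), of t'] i y' ne
    by (auto simp: of_bool_def split: if_splits)
  \<comment> \<open>On this edge of colour \<open>x\<close> the second triple scores exactly 1,
    which the first already earns by its colour.\<close>
  have y: "y \<noteq> YC i" using ag(1)[OF i(1), of t] i y' z' ne
    by (auto simp: of_bool_def split: if_splits)
  \<comment> \<open>On the partner edge the second triple scores through the centre, while the first
    can match only the leaf.\<close>
  have z: "z = ZL i (\<not> t)" "\<kappa> i (\<not> t) \<noteq> x'"
    using ag(1)[OF i(1), of "\<not> t"] i y y' z' by (auto simp: of_bool_def split: if_splits)
  have "y = v \<or> z = w" using eq[rule_format, OF v] ne by (auto simp: of_bool_def split: if_splits)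
  moreover have "z \<noteq> w" using v z by (auto simp: path_set_def)
  ultimately show ?thesis by simp
qed

text \<open>The same argument with second and third coordinates exchanged.\<close>

lemma path_set_twice_third:
  assumes eq: "\<forall>q\<in>path_set p r d \<kappa> \<mu>. agree (x, y, z) q = agree (x', y', z') q"
    and ne: "x \<noteq> x'" and tw: "twice r \<mu> x"
    and v: "(x', v, w) \<in> path_set p r d \<kappa> \<mu>"
  shows "w = z"
proof -
  note ag = agree_path_set[OF eq]
  obtain i i' t t' where i: "i < r" "i' < r" "i \<noteq> i'" "\<mu> i t = x" "\<mu> i' t' = x"
    "\<mu> i (\<not> t) \<noteq> x" and z': "z' = ZC i"
  proof -
    obtain i i' t t' where i: "i < r" "i' < r" "i \<noteq> i'" "\<mu> i t = x" "\<mu> i' t' = x"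
      "\<mu> i (\<not> t) \<noteq> x" "\<mu> i' (\<not> t') \<noteq> x" using tw unfolding twice_def by blast
    have "z' = ZC i \<or> z' = ZC i'"
      using ag(2)[OF i(1), of t] ag(2)[OF i(2), of t'] i ne
      by (auto simp: of_bool_def split: if_splits)
    then show ?thesis using i that[of i i' t t'] that[of i' i t' t] by metis
  qed
  have y': "y' = YL i' t'" using ag(2)[OF i(2), of t'] i z' ne
    by (auto simp: of_bool_def split: if_splits)
  have z: "z \<noteq> ZC i" using ag(2)[OF i(1), of t] i y' z' ne
    by (auto simp: of_bool_def split: if_splits)
  have y: "y = YL i (\<not> t)" "\<mu> i (\<not> t) \<noteq> x'"
    using ag(2)[OF i(1), of "\<not> t"] i z y' z' by (auto simp: of_bool_def split: if_splits)
  have "y = v \<or> z = w" using eq[rule_format, OF v] ne by (auto simp: of_bool_def split: if_splits)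
  moreover have "y \<noteq> v" using v y by (auto simp: path_set_def)
  ultimately show ?thesis by simp
qed

text \<open>In an unresolved pair of different colours, a \<open>twice\<close> colour forces all
  edges of the other colour through one vertex. \<open>multi\<close> excludes a common second
  coordinate; a common third one is excluded if the other colour is \<open>twice\<close> on the
  paths centred at \<open>ZC\<close>.\<close>

lemma resolves_path_set:
  assumes col: "0 \<in> A" "\<And>i t. i < p \<Longrightarrow> \<kappa> i t \<in> A" "\<And>j t. j < r \<Longrightarrow> \<mu> j t \<in> A"
    and de: "d \<Longrightarrow> e"
    and multi: "\<And>x x'. x \<in> A \<Longrightarrow> x' \<in> A \<Longrightarrow> x \<noteq> x' \<Longrightarrow>
      \<exists>v w v' w'. (x, v, w) \<in> path_set p r d \<kappa> \<mu> \<and> (x, v', w') \<in> path_set p r d \<kappa> \<mu> \<and> v \<noteq> v'"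
    and tw: "\<And>x x'. x \<in> A \<Longrightarrow> x' \<in> A \<Longrightarrow> x \<noteq> x' \<Longrightarrow>
      twice p \<kappa> x \<or> twice p \<kappa> x' \<or> twice r \<mu> x \<and> twice r \<mu> x'"
  shows "resolves A (seconds p r d) (thirds p r e) (path_set p r d \<kappa> \<mu>)"
  unfolding resolves_def
proof (intro conjI ballI impI)
  show "path_set p r d \<kappa> \<mu> \<subseteq> A \<times> seconds p r d \<times> thirds p r e"
    using col de by (auto simp: path_set_def seconds_def thirds_def)
  fix s s' assume s: "s \<in> A \<times> seconds p r d \<times> thirds p r e" "s' \<in> A \<times> seconds p r d \<times> thirds p r e"
    and eq: "\<forall>q\<in>path_set p r d \<kappa> \<mu>. agree s q = agree s' q"
  obtain x y z x' y' z' where e: "s = (x, y, z)" "s' = (x', y', z')" by (metis prod_cases3)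
  note eq = eq[unfolded e]
  have eq': "\<forall>q\<in>path_set p r d \<kappa> \<mu>. agree (x', y', z') q = agree (x, y, z) q"
    using eq by simp
  have A: "x \<in> A" "x' \<in> A" using s e by auto
  have "x = x'"
  proof (rule ccontr)
    assume ne: "x \<noteq> x'"
    consider "twice p \<kappa> x" | "twice p \<kappa> x'" | "twice r \<mu> x" "twice r \<mu> x'"
      using tw A ne by blast
    then show False
    proof cases
      case 1
      then show False using path_set_twice_second[OF eq ne] multi[OF A(2,1) ne[symmetric]] by blast
    next
      case 2
      then show False using path_set_twice_second[OF eq' ne[symmetric]] multi[OF A ne] by blast
    next
      case 3
      obtain j j' t t' where j: "j < r" "j' < r" "j \<noteq> j'" "\<mu> j t = x'" "\<mu> j' t' = x'"
        using 3(2) unfolding twice_def by blast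
      have "(x', YL j t, ZC j) \<in> path_set p r d \<kappa> \<mu>" "(x', YL j' t', ZC j') \<in> path_set p r d \<kappa> \<mu>"
        using j path_setI(2) by metis+
      then have "ZC j = z" "ZC j' = z" using path_set_twice_third[OF eq ne 3(1)] by blast+
      then show False using j(3) by blast
    qed
  qed
  moreover have "y = y' \<and> z = z'"
    using path_set_same_colour eq s unfolding e \<open>x = x'\<close> by auto
  ultimately show "s = s'" by (simp add: e)
qed

section \<open>Cyclic colourings of the paths\<close>

definition cyc :: "nat \<Rightarrow> nat \<Rightarrow> bool \<Rightarrow> nat" where
  "cyc m i t = (i + of_bool t) mod m"

text \<open>Colour \<open>x\<close> lies on path \<open>x\<close> and on its cyclic predecessor;
  \<open>2 \<le> m\<close> gives the partner edges other colours. The offset \<open>l\<close> allows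
  a second palette.\<close>

lemma twice_cyc:
  assumes "2 \<le> m" "m \<le> n" "x < m"
  shows "twice n (\<lambda>i t. l + cyc m i t) (l + x)"
proof -
  define i' where "i' = (if x = 0 then m - 1 else x - 1)"
  have "(x + 1) mod m \<noteq> x"
    using assms by (cases "x + 1 = m") auto
  moreover have "i' < m" "i' \<noteq> x" "(i' + 1) mod m = x"
    using assms by (auto simp: i'_def)
  ultimately show ?thesis
    unfolding twice_def cyc_def using assms
    by (intro exI[of _ x] exI[of _ i'] exI[of _ False] exI[of _ True]) auto
qed

lemma ex_resolves_paths:
  assumes "1 \<le> a" "a \<le> p + r" "r \<le> p" "a = 1 \<or> 2 \<le> p" "d \<Longrightarrow> e"
  shows "\<exists>Q. resolves {..<a} (seconds p r d) (thirds p r e) Q \<and> finite Q \<and>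
    card Q \<le> 2 * p + 2 * r + of_bool d"
proof -
  \<comment> \<open>The first \<open>min a p\<close> colours go round the paths centred at
    \<open>YC\<close>, the remaining \<open>a - p\<close> round those centred at \<open>ZC\<close>.
    If none remain, the latter take the default colour 0.\<close>
  define \<kappa> where "\<kappa> i t = cyc (min a p) i t" for i t
  define \<mu> where "\<mu> j t = (if a \<le> p then 0 else p + cyc (a - p) j t)" for j t
  have tk: "twice p \<kappa> x" if "x < a" "x < p" "2 \<le> a" for x
    using twice_cyc[of "min a p" p x 0] that assms by (simp add: \<kappa>_def[abs_def])
  have tm: "twice r \<mu> x" if "p \<le> x" "x < a" "p + 2 \<le> a" for x
    using twice_cyc[of "a - p" r "x - p" p] that assms by (simp add: \<mu>_def[abs_def])
  have "resolves {..<a} (seconds p r d) (thirds p r e) (path_set p r d \<kappa> \<mu>)"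
  proof (rule resolves_path_set)
    show "0 \<in> {..<a}" using assms by simp
    show "\<kappa> i t \<in> {..<a}" if "i < p" for i t
      using assms that mod_less_divisor[of "min a p" "i + of_bool t"] by (simp add: \<kappa>_def cyc_def)
    show "\<mu> j t \<in> {..<a}" for j t
    proof (cases "a \<le> p")
      case True
      then show ?thesis using assms by (simp add: \<mu>_def)
    next
      case False
      then have "cyc (a - p) j t < a - p" by (simp add: cyc_def)
      with False show ?thesis by (simp add: \<mu>_def)
    qed
    show e if d using that assms by simp
    fix x x' :: nat assume x: "x \<in> {..<a}" "x' \<in> {..<a}" "x \<noteq> x'"
    then have a2: "2 \<le> a" by auto
    show "twice p \<kappa> x \<or> twice p \<kappa> x' \<or> twice r \<mu> x \<and> twice r \<mu> x'"
    proof (cases "x < p \<or> x' < p")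
      case True
      then show ?thesis using tk x a2 by auto
    next
      case False
      \<comment> \<open>Two distinct colours from \<open>p\<close> on force
        \<open>p + 2 \<le> a\<close>.\<close>
      then show ?thesis using tm[of x] tm[of x'] x by auto
    qed
    show "\<exists>v w v' w'. (x, v, w) \<in> path_set p r d \<kappa> \<mu> \<and> (x, v', w') \<in> path_set p r d \<kappa> \<mu> \<and> v \<noteq> v'"
    proof (cases "x < p")
      case True
      then have "twice p \<kappa> x" using tk x a2 by auto
      then obtain i i' t t' where i: "i < p" "i' < p" "i \<noteq> i'" "\<kappa> i t = x" "\<kappa> i' t' = x"
        unfolding twice_def by blast
      have "(x, YC i, ZL i t) \<in> path_set p r d \<kappa> \<mu>" "(x, YC i', ZL i' t') \<in> path_set p r d \<kappa> \<mu>"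
        using i path_setI(1) by metis+
      then show ?thesis using i(3) by blast
    next
      case False
      have "\<exists>j j' t t'. j < r \<and> j' < r \<and> (j, t) \<noteq> (j', t') \<and> \<mu> j t = x \<and> \<mu> j' t' = x"
      proof (cases "p + 2 \<le> a")
        case True
        then show ?thesis using tm[of x] x False unfolding twice_def by auto
      next
        case h: False
        \<comment> \<open>A single leftover colour fills whole paths and is not
          \<open>twice\<close>, but both leaves of path 0 carry it.\<close>
        then have "a = p + 1" "x = p" using x False by auto
        then show ?thesis
          using assms
          by (intro exI[of _ 0] exI[of _ False] exI[of _ True]) (auto simp: \<mu>_def cyc_def)
      qed
      then obtain j j' t t' where j: "j < r" "j' < r" "(j, t) \<noteq> (j', t')" "\<mu> j t = x" "\<mu> j' t' = x"
        by blast
      have "(x, YL j t, ZC j) \<in> path_set p r d \<kappa> \<mu>" "(x, YL j' t', ZC j') \<in> path_set p r d \<kappa> \<mu>"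
        using j path_setI(2) by metis+
      then show ?thesis using j(3) by blast
    qed
  qed
  then show ?thesis using finite_path_set card_path_set by blast
qed

section \<open>Transfer to intervals and choice of parameters\<close>

lemma resolves_image:
  assumes res: "resolves A B C Q"
    and f: "bij_betw f A A'" and g: "bij_betw g B B'" and h: "bij_betw h C C'"
  shows "resolves A' B' C' ((\<lambda>(x, y, z). (f x, g y, h z)) ` Q)"
proof -
  define F where "F = (\<lambda>(x, y, z). (f x, g y, h z))"
  have im: "F ` (A \<times> B \<times> C) = A' \<times> B' \<times> C'"
    using f g h by (force simp: F_def bij_betw_def image_iff)
  \<comment> \<open>\<open>agree\<close> sees only equality of coordinates, which bijections
    preserve.\<close>
  have ag: "agree (F s) (F q) = agree s q" if "s \<in> A \<times> B \<times> C" "q \<in> A \<times> B \<times> C" for s q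
    using that f g h by (auto simp: F_def agree_def bij_betw_def inj_on_eq_iff)
  have sub: "Q \<subseteq> A \<times> B \<times> C" using res by (simp add: resolves_def)
  have "resolves A' B' C' (F ` Q)"
    unfolding resolves_def im[symmetric]
  proof (intro conjI ballI impI)
    show "F ` Q \<subseteq> F ` (A \<times> B \<times> C)" using sub by blast
    fix s s' assume "s \<in> F ` (A \<times> B \<times> C)" "s' \<in> F ` (A \<times> B \<times> C)"
      and eq: "\<forall>q\<in>F ` Q. agree s q = agree s' q"
    then obtain u u' where u: "s = F u" "s' = F u'" "u \<in> A \<times> B \<times> C" "u' \<in> A \<times> B \<times> C" by blast
    have "\<forall>q\<in>Q. agree u q = agree u' q"
      using eq ag u sub by (metis imageI subsetD)
    then have "u = u'" using res u unfolding resolves_def by blast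
    then show "s = s'" using u by simp
  qed
  then show ?thesis by (simp add: F_def)
qed

lemma finite_seconds: "finite (seconds p r d)" and finite_thirds: "finite (thirds p r e)"
  by (auto simp: seconds_def thirds_def)

lemma ex_resolves_nat:
  assumes "1 \<le> a" "a \<le> p + r" "r \<le> p" "a = 1 \<or> 2 \<le> p" "d \<Longrightarrow> e"
    and "b = p + 2 * r + 1 + of_bool d" "c = 2 * p + r + of_bool e"
  shows "\<exists>Q. resolves {1..a} {1..b} {1..c} Q \<and> finite Q \<and> card Q \<le> 2 * p + 2 * r + of_bool d"
proof -
  obtain Q where Q: "resolves {..<a} (seconds p r d) (thirds p r e) Q" "finite Q"
    "card Q \<le> 2 * p + 2 * r + of_bool d" using ex_resolves_paths[OF assms(1-5)] by blast
  obtain f where f: "bij_betw f {..<a} {1..a}"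
    using finite_same_card_bij[of "{..<a}" "{1..a}"] by auto
  obtain g where g: "bij_betw g (seconds p r d) {1..b}"
    using finite_same_card_bij[of "seconds p r d" "{1..b}"] assms(6) finite_seconds
    by (auto simp: card_seconds)
  obtain h where h: "bij_betw h (thirds p r e) {1..c}"
    using finite_same_card_bij[of "thirds p r e" "{1..c}"] assms(7) finite_thirds
    by (auto simp: card_thirds)
  show ?thesis
    using resolves_image[OF Q(1) f g h] Q(2,3) card_image_le[OF Q(2)] order_trans by blast
qed

text \<open>
  The smallest case escapes the general colouring: with only one path of each kind, no colour
  can lie on two paths of the same kind.
\<close>

lemma resolves_2_4_4:
  "resolves {1..2} {1..4} {1..4} {(1 :: nat, 1 :: nat, 1 :: nat), (2, 1, 2), (2, 2, 3), (2, 3, 3)}"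
proof -
  let ?Q = "[(1 :: nat, 1 :: nat, 1 :: nat), (2, 1, 2), (2, 2, 3), (2, 3, 3)]"
  let ?V = "List.product [1, 2 :: nat] (List.product [1, 2, 3, 4 :: nat] [1, 2, 3, 4 :: nat])"
  have eq: "{1..2} = {1, 2 :: nat}" "{1..4} = {1, 2, 3, 4 :: nat}"
    by auto
  \<comment> \<open>Resolving means that the 32 agreement vectors are distinct, a finite
    check.\<close>
  have "distinct (map (\<lambda>s. map (agree s) ?Q) ?V)"
    by code_simp
  then have "inj_on (\<lambda>s. map (agree s) ?Q) (set ?V)"
    by (simp only: distinct_map)
  moreover have "set ?V = {1..2} \<times> {1..4} \<times> {1..4}"
    by (simp only: set_product eq list.set)
  moreover have "set ?Q \<subseteq> set ?V" by simp
  ultimately have "resolves {1..2} {1..4} {1..4} (set ?Q)"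
    unfolding resolves_def inj_on_def by (simp only: map_eq_conv)
  then show ?thesis by (simp only: list.set)
qed

lemma ex_resolves:
  fixes a b c :: nat
  assumes "1 \<le> a" "a \<le> b" "b \<le> c" "3 * a < b + c" "c < 2 * b"
  shows "\<exists>Q. resolves {1..a} {1..b} {1..c} Q \<and> finite Q \<and> card Q \<le> 2 * (b + c - 1) div 3"
proof -
  \<comment> \<open>The size equations add up to
    \<open>b + c = 3 * (p + r) + 1 + of_bool d + of_bool e\<close>: the residue modulo 3 dictates
    \<open>d\<close> and \<open>e\<close>, then \<open>p\<close> and \<open>r\<close> are solved
    for. \<open>c < 2 * b\<close> keeps \<open>r\<close> nonnegative, and
    \<open>3 * a < b + c\<close> gives \<open>a \<le> p + r\<close>.\<close>
  define k where "k = (b + c) div 3"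
  consider "b + c = 3 * k" | "b + c = 3 * k + 1" | "b + c = 3 * k + 2"
    unfolding k_def by linarith
  then show ?thesis
  proof cases
    case 1
    have "2 * (c - k) + 2 * (b - 1 - k) + of_bool True \<le> 2 * (b + c - 1) div 3"
      using 1 assms by simp
    moreover have "a = 1 \<or> 2 \<le> c - k" using 1 assms by linarith
    moreover have "a \<le> c - k + (b - 1 - k)" "b - 1 - k \<le> c - k"
      "b = c - k + 2 * (b - 1 - k) + 1 + of_bool True"
      "c = 2 * (c - k) + (b - 1 - k) + of_bool True"
      using 1 assms by simp_all
    ultimately show ?thesis
      using ex_resolves_nat[OF assms(1), of "c - k" "b - 1 - k" True True b c] order_trans by blast
  next
    case 2
    have "2 * (c - k) + 2 * (b - 1 - k) + of_bool False \<le> 2 * (b + c - 1) div 3"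
      using 2 assms by simp
    moreover have "a = 1 \<or> 2 \<le> c - k" using 2 assms by linarith
    moreover have "a \<le> c - k + (b - 1 - k)" "b - 1 - k \<le> c - k"
      "b = c - k + 2 * (b - 1 - k) + 1 + of_bool False"
      "c = 2 * (c - k) + (b - 1 - k) + of_bool False"
      using 2 assms by simp_all
    ultimately show ?thesis
      using ex_resolves_nat[OF assms(1), of "c - k" "b - 1 - k" False False b c] order_trans by blast
  next
    case 3
    show ?thesis
    proof (cases "a = 1 \<or> 2 \<le> c - 1 - k")
      case True
      have "2 * (c - 1 - k) + 2 * (b - 1 - k) + of_bool False \<le> 2 * (b + c - 1) div 3"
        using 3 assms by simp
      moreover have "a \<le> c - 1 - k + (b - 1 - k)" "b - 1 - k \<le> c - 1 - k"
        "b = c - 1 - k + 2 * (b - 1 - k) + 1 + of_bool False"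
        "c = 2 * (c - 1 - k) + (b - 1 - k) + of_bool True"
        using 3 assms by simp_all
      ultimately show ?thesis
        using True ex_resolves_nat[OF assms(1), of "c - 1 - k" "b - 1 - k" False True b c]
          order_trans by blast
    next
      case False
      \<comment> \<open>Having \<open>2 \<le> a\<close> but \<open>p < 2\<close> leaves one
        instance, with \<open>p = r = 1\<close>.\<close>
      then have "a = 2" "b = 4" "c = 4" using 3 assms by linarith+
      then show ?thesis using resolves_2_4_4
        by (intro exI[of _ "{(1, 1, 1), (2, 1, 2), (2, 2, 3), (2, 3, 3)}"]) simp
    qed
  qed
qed

section \<open>Combining both bounds\<close>

theorem theorem7:
  fixes a b c :: nat
  assumes "1 \<le> a" and "1 \<le> b" and "1 \<le> c"
    and "a \<le> b" and "b \<le> c"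
    and "3 * a < b + c" and "2 * b > c"
  shows "int (metric_dimension (complete_graph a \<box> complete_graph b \<box> complete_graph c)) =
    \<lfloor>(2 / 3 :: real) * (real b + real c - 1)\<rfloor>"
proof -
  define m where "m = 2 * (b + c - 1) div 3"
  have lower: "m \<le> card Q" if "finite Q" "resolves {1..a} {1..b} {1..c} Q" for Q
  proof -
    have "2 * (b + c) \<le> 3 * card Q + 4"
      using resolves_card_lower[OF that(2,1)] assms by simp
    \<comment> \<open>Subtracting 2 turns the slack 4 into 2, less than 3, so rounding yields
      exactly \<open>m\<close>.\<close>
    then have "2 * (b + c - 1) < Suc (card Q) * 3" using assms by simp
    then show ?thesis unfolding m_def by (metis less_mult_imp_div_less less_Suc_eq_le)
  qed
  obtain Q where Q: "resolves {1..a} {1..b} {1..c} Q" "finite Q" "card Q \<le> m"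
    using ex_resolves[of a b c] assms unfolding m_def by auto
  have "metric_dimension (K3 a b c) = m"
    unfolding metric_dimension_def resolving_set_K3
  proof (rule Least_equality)
    have "card Q = m" using Q lower by (simp add: antisym)
    with Q show "\<exists>U. finite U \<and> resolves {1..a} {1..b} {1..c} U \<and> card U = m" by blast
    show "m \<le> n" if "\<exists>U. finite U \<and> resolves {1..a} {1..b} {1..c} U \<and> card U = n" for n
      using that lower by blast
  qed
  moreover have "\<lfloor>(2 / 3 :: real) * (real b + real c - 1)\<rfloor> = int m"
  proof (rule floor_unique)
    have "3 * m \<le> 2 * (b + c - 1)" "2 * (b + c - 1) < 3 * m + 3" unfolding m_def by linarith+
    \<comment> \<open>Natural subtraction is cleared before passing to the reals.\<close>
    then have "3 * m + 2 \<le> 2 * (b + c)" "2 * (b + c) < 3 * m + 5" using assms by simp_all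
    then have "real (3 * m + 2) \<le> real (2 * (b + c))" "real (2 * (b + c)) < real (3 * m + 5)"
      by (simp_all only: of_nat_le_iff of_nat_less_iff)
    then have "3 * real m + 2 \<le> 2 * (real b + real c)" "2 * (real b + real c) < 3 * real m + 5"
      by simp_all
    then show "real_of_int (int m) \<le> (2 / 3) * (real b + real c - 1)"
      "(2 / 3) * (real b + real c - 1) < real_of_int (int m) + 1" by auto
  qed
  ultimately show ?thesis by simp
qed

end
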